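(* Any deterministic strategyproof mechanism has an approximation ratio of at least $\frac{2(1+2\sqrt2)}{7}$ for minimizing the maximum cost when locations are public and group memberships are private. That is, for every $\rho<\frac{2(1+2\sqrt2)}{7}$ there is no deterministic mechanism that is strategyproof when locations are public and group memberships are private and has approximation ratio $\rho$ for the maximum cost.
   Context: Setting. $N=\{1,\dots,n\}$ is a set of agents, $I=[0,1]$, $[m]=\{1,\dots,m\}$ indexes groups. Agent $i$ has a profile $r_i=(x_i,g_i)$ with location $x_i\in I$ and group $g_i\in[m]$; $\mathbf r=(r_1,\dots,r_n)$. $G_j=\{i\in N: g_i=j\}$. $d(a,b)=|a-b|$. Each group $j$ has a known externality factor $\alpha_j\ge 0$. If the facility is at $y\in I$, the cost of agent $i$ is $$c_i(y,\mathbf r)=d(y,x_i)+\alpha_{g_i}\sum_{k\in G_{g_i}\setminus\{i\}}(1-d(y,x_k)).$$ Standing assumption on (true) profiles: $\alpha_j\le 1/(|G_j|-1)$ for each group $j$ (void if $|G_j|\le 1$). Maximum cost: $\mathrm{MC}(y,\mathbf r)=\max_{i\in N}c_i(y,\mathbf r)$. A deterministic mechanism $f$ assigns, for every $n$, $m$ and $(\alpha_j)_{j\in[m]}$, a facility location $f(\mathbf r)\in I$ to each profile $\mathbf r$. Strategyproof when locations are public and group memberships are private: for every true profile $\mathbf r$, every reported profile $\mathbf r'$ with the same locations ($x'_k=x_k$ for all $k$) and every agent $i$, $c_i(f(r_i,\mathbf r'_{-i}),\mathbf r)\le c_i(f(\mathbf r'),\mathbf r)$, where $\mathbf r'_{-i}$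 are the reports of all agents other than $i$. $f$ has approximation ratio $\rho$ for the maximum cost if for all $n,m,(\alpha_j)$ and all profiles $\mathbf r$ satisfying the standing assumption, $\mathrm{MC}(f(\mathbf r),\mathbf r)\le\rho\min_{z\in I}\mathrm{MC}(z,\mathbf r)$. *)

theory Defs
  imports "HOL-Analysis.Analysis"
begin

text \<open>
  Agents are the elements of \<open>{1..n}\<close> and groups the elements of \<open>{1..m}\<close>.
  Externality factors and profiles are extensional functions (\<open>\<rightarrow>\<^sub>E\<close>), so that a mechanism,
  which is a function of \<open>n\<close>, \<open>m\<close>, the factors and the profile, receives no
  information beyond the values on \<open>{1..m}\<close> and \<open>{1..n}\<close>.
\<close>

type_synonym factors = "nat \<Rightarrow> real"
type_synonym profile = "nat \<Rightarrow> real \<times> nat"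
type_synonym mechanism = "nat \<Rightarrow> nat \<Rightarrow> factors \<Rightarrow> profile \<Rightarrow> real"

abbreviation loc :: "profile \<Rightarrow> nat \<Rightarrow> real" where
  "loc r i \<equiv> fst (r i)"

abbreviation grp :: "profile \<Rightarrow> nat \<Rightarrow> nat" where
  "grp r i \<equiv> snd (r i)"

definition factor_vectors :: "nat \<Rightarrow> factors set" where
  "factor_vectors m = {1..m} \<rightarrow>\<^sub>E {0..}"

definition profiles :: "nat \<Rightarrow> nat \<Rightarrow> profile set" where
  "profiles n m = {1..n} \<rightarrow>\<^sub>E ({0..1} \<times> {1..m})"

definition group_members :: "nat \<Rightarrow> profile \<Rightarrow> nat \<Rightarrow> nat set" where
  "group_members n r j = {i \<in> {1..n}. grp r i = j}"

definition agent_cost :: "nat \<Rightarrow> factors \<Rightarrow> profile \<Rightarrow> nat \<Rightarrow> real \<Rightarrow> real" where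
  "agent_cost n \<alpha> r i y =
     dist y (loc r i) + \<alpha> (grp r i) * (\<Sum>k \<in> group_members n r (grp r i) - {i}. 1 - dist y (loc r k))"

definition max_cost :: "nat \<Rightarrow> factors \<Rightarrow> profile \<Rightarrow> real \<Rightarrow> real" where
  "max_cost n \<alpha> r y = Max ((\<lambda>i. agent_cost n \<alpha> r i y) ` {1..n})"

text \<open>
  The bound on the factors is required of true profiles only; reported profiles
  range over all of \<open>profiles n m\<close>.
\<close>

definition admissible_profiles :: "nat \<Rightarrow> nat \<Rightarrow> factors \<Rightarrow> profile set" where
  "admissible_profiles n m \<alpha> =
     {r \<in> profiles n m. \<forall>j \<in> {1..m}. card (group_members n r j) \<ge> 2 \<longrightarrow>
        \<alpha> j \<le> 1 / (real (card (group_members n r j)) - 1)}"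

definition is_mechanism :: "mechanism \<Rightarrow> bool" where
  "is_mechanism f \<longleftrightarrow>
     (\<forall>n\<ge>1. \<forall>m\<ge>1. \<forall>\<alpha> \<in> factor_vectors m. \<forall>r \<in> profiles n m. f n m \<alpha> r \<in> {0..1})"

definition strategyproof_private_groups :: "mechanism \<Rightarrow> bool" where
  "strategyproof_private_groups f \<longleftrightarrow>
     (\<forall>n\<ge>1. \<forall>m\<ge>1. \<forall>\<alpha> \<in> factor_vectors m.
        \<forall>r \<in> admissible_profiles n m \<alpha>. \<forall>r' \<in> profiles n m.
          (\<forall>k \<in> {1..n}. loc r' k = loc r k) \<longrightarrow>
          (\<forall>i \<in> {1..n}. agent_cost n \<alpha> r i (f n m \<alpha> (r'(i := r i)))
                         \<le> agent_cost n \<alpha> r i (f n m \<alpha> r')))"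

text \<open>The infimum is a minimum, see \<open>max_cost_attains_Inf\<close> below.\<close>

definition has_max_cost_ratio :: "mechanism \<Rightarrow> real \<Rightarrow> bool" where
  "has_max_cost_ratio f \<rho> \<longleftrightarrow>
     (\<forall>n\<ge>1. \<forall>m\<ge>1. \<forall>\<alpha> \<in> factor_vectors m. \<forall>r \<in> admissible_profiles n m \<alpha>.
        max_cost n \<alpha> r (f n m \<alpha> r) \<le> \<rho> * (INF z \<in> {0..1}. max_cost n \<alpha> r z))"

lemma continuous_on_Max_image:
  fixes g :: "'i \<Rightarrow> 'a::topological_space \<Rightarrow> real"
  assumes "finite A" "A \<noteq> {}" "\<And>i. i \<in> A \<Longrightarrow> continuous_on S (g i)"
  shows "continuous_on S (\<lambda>y. Max ((\<lambda>i. g i y) ` A))"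
  using assms
proof (induction A rule: finite_ne_induct)
  case (singleton x)
  then show ?case by simp
next
  case (insert x F)
  then have "continuous_on S (\<lambda>y. max (g x y) (Max ((\<lambda>i. g i y) ` F)))"
    by (intro continuous_on_max) auto
  with insert show ?case by simp
qed

lemma max_cost_attains_Inf:
  assumes "n \<ge> 1"
  shows "\<exists>z \<in> {0..1}. max_cost n \<alpha> r z = (INF z \<in> {0..1}. max_cost n \<alpha> r z)
           \<and> (\<forall>y \<in> {0..1}. max_cost n \<alpha> r z \<le> max_cost n \<alpha> r y)"
proof -
  have "continuous_on {0..1} (max_cost n \<alpha> r)"
    unfolding max_cost_def agent_cost_def using assms
    by (intro continuous_on_Max_image continuous_intros) auto
  then obtain z where z: "z \<in> {0..1}" "\<forall>y \<in> {0..1}. max_cost n \<alpha> r z \<le> max_cost n \<alpha> r y"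
    using continuous_attains_inf[of "{0..1::real}" "max_cost n \<alpha> r"] by auto
  have "(INF z \<in> {0..1}. max_cost n \<alpha> r z) = max_cost n \<alpha> r z"
    by (rule cInf_eq_minimum) (use z in auto)
  with z show ?thesis by auto
qed

end

theory Submission
  imports Defs
begin

text \<open>
  One agent sits at \<open>0\<close> and two agents sit at \<open>1\<close>; every group has factor \<open>\<alpha> \<le> 1\<close>. If the two
  agents at \<open>1\<close> form a group, each of them has cost \<open>1 - (1 - \<alpha>) y\<close>, and if they are separated, cost
  \<open>1 - y\<close>. Both are decreasing in \<open>y\<close>, so strategyproofness for the third agent in both directions
  forces the same location \<open>y\<close> on the two profiles. The optima are \<open>1/2\<close> (all separate) and
  \<open>1/(2 - \<alpha>)\<close> (grouped), so \<open>y \<le> \<rho>/2\<close> and \<open>1 - (1 - \<alpha>) y \<le> \<rho>/(2 - \<alpha>)\<close>, which gives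
  \<open>\<rho> \<ge> 2u/(u\<^sup>2 - u + 2)\<close> for \<open>u = 2 - \<alpha>\<close>. This bound is largest for \<open>u = sqrt 2\<close>.
\<close>

definition separate_profile :: profile where
  "separate_profile = (\<lambda>i\<in>{1..3}. (if i = 1 then 0 else 1, i))"

text \<open>\<open>min i 2\<close> moves only agent 3, into the group of agent 2. Group 3 stays
  empty, so both profiles share the same \<open>m\<close> and factors and differ in one
  report.\<close>

definition paired_profile :: profile where
  "paired_profile = (\<lambda>i\<in>{1..3}. (if i = 1 then 0 else 1, min i 2))"

definition const_factors :: "real \<Rightarrow> factors" where
  "const_factors a = (\<lambda>j\<in>{1..3}. a)"

lemma atLeastAtMost_1_3: "{1..3::nat} = {1, 2, 3}"
  by auto

lemma const_factors_in_factor_vectors: "a \<ge> 0 \<Longrightarrow> const_factors a \<in> factor_vectors 3"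
  by (auto simp: const_factors_def factor_vectors_def)

lemma group_members_separate:
  "j \<in> {1..3} \<Longrightarrow> group_members 3 separate_profile j = {j}"
  by (auto simp: group_members_def separate_profile_def)

lemma group_members_paired:
  "group_members 3 paired_profile j = (if j = 1 then {1} else if j = 2 then {2, 3} else {})"
  by (auto simp: group_members_def paired_profile_def atLeastAtMost_1_3)

lemma separate_profile_admissible: "separate_profile \<in> admissible_profiles 3 3 (const_factors a)"
  by (auto simp: admissible_profiles_def profiles_def group_members_separate)
     (auto simp: separate_profile_def)

text \<open>The only group with two members allows factors up to 1 / (2 - 1) = 1.\<close>

lemma paired_profile_admissible:
  "a \<le> 1 \<Longrightarrow> paired_profile \<in> admissible_profiles 3 3 (const_factors a)"
  by (auto simp: admissible_profiles_def profiles_def group_members_paired const_factors_def)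
     (auto simp: paired_profile_def)

lemma agent_cost_separate:
  assumes "y \<in> {0..1}" "i \<in> {1..3}"
  shows "agent_cost 3 (const_factors a) separate_profile i y = (if i = 1 then y else 1 - y)"
proof -
  have "grp separate_profile i = i" "loc separate_profile i = (if i = 1 then 0 else 1)"
    using assms by (auto simp: separate_profile_def)
  with assms show ?thesis
    by (simp add: agent_cost_def group_members_separate dist_real_def)
qed

text \<open>Agents 2 and 3 share the location 1, so each adds
  \<open>a * (1 - (1 - y)) = a * y\<close> to the other's distance \<open>1 - y\<close>.\<close>

lemma agent_cost_paired:
  assumes "y \<in> {0..1}" "i \<in> {1..3}"
  shows "agent_cost 3 (const_factors a) paired_profile i y = (if i = 1 then y else 1 - (1 - a) * y)"
proof -
  have profile: "grp paired_profile k = min k 2" "loc paired_profile k = (if k = 1 then 0 else 1)"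
    if "k \<in> {1..3}" for k
    using that by (auto simp: paired_profile_def)
  have others: "group_members 3 paired_profile (min i 2) - {i} =
      (if i = 1 then {} else if i = 2 then {3} else {2})"
    using assms by (auto simp: group_members_paired)
  show ?thesis
    using assms unfolding agent_cost_def profile(1)[OF assms(2)] others
    by (auto simp: profile const_factors_def dist_real_def algebra_simps)
qed

lemma max_cost_separate:
  "y \<in> {0..1} \<Longrightarrow> max_cost 3 (const_factors a) separate_profile y = max y (1 - y)"
  unfolding max_cost_def atLeastAtMost_1_3 by (simp add: agent_cost_separate)

lemma max_cost_paired:
  "y \<in> {0..1} \<Longrightarrow> max_cost 3 (const_factors a) paired_profile y = max y (1 - (1 - a) * y)"
  unfolding max_cost_def atLeastAtMost_1_3 by (simp add: agent_cost_paired)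

lemma strategyproof_same_location:
  assumes f: "is_mechanism f" "strategyproof_private_groups f" and a: "0 \<le> a" "a < 1"
  shows "f 3 3 (const_factors a) separate_profile = f 3 3 (const_factors a) paired_profile"
proof -
  let ?\<alpha> = "const_factors a"
  have \<alpha>: "?\<alpha> \<in> factor_vectors 3"
    using a by (simp add: const_factors_in_factor_vectors)
  have adm: "separate_profile \<in> admissible_profiles 3 3 ?\<alpha>"
    "paired_profile \<in> admissible_profiles 3 3 ?\<alpha>"
    using a by (simp_all add: separate_profile_admissible paired_profile_admissible)
  then have prof: "separate_profile \<in> profiles 3 3" "paired_profile \<in> profiles 3 3"
    by (simp_all add: admissible_profiles_def)
  have upd: "paired_profile(3 := separate_profile 3) = separate_profile"
    "separate_profile(3 := paired_profile 3) = paired_profile"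
    by (auto simp: fun_eq_iff separate_profile_def paired_profile_def)
  have loc: "\<forall>k\<in>{1..3}. loc paired_profile k = loc separate_profile k"
    by (simp add: separate_profile_def paired_profile_def)
  define s where "s = f 3 3 ?\<alpha> separate_profile"
  define p where "p = f 3 3 ?\<alpha> paired_profile"
  have range: "s \<in> {0..1}" "p \<in> {0..1}"
    using f(1) \<alpha> prof unfolding is_mechanism_def s_def p_def by simp_all
  have sp: "agent_cost 3 ?\<alpha> r 3 (f 3 3 ?\<alpha> (r'(3 := r 3))) \<le> agent_cost 3 ?\<alpha> r 3 (f 3 3 ?\<alpha> r')"
    if "r \<in> admissible_profiles 3 3 ?\<alpha>" "r' \<in> profiles 3 3" "\<forall>k\<in>{1..3}. loc r' k = loc r k"
    for r r'
    using f(2) \<alpha> that unfolding strategyproof_private_groups_def by simp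
  \<comment> \<open>Truth separate, misreport paired: \<open>1 - s \<le> 1 - p\<close>.\<close>
  have "p \<le> s"
    using sp[OF adm(1) prof(2) loc] range
    by (simp add: upd agent_cost_separate flip: s_def p_def)
  \<comment> \<open>The reverse deviation; the positive factor \<open>1 - a\<close> cancels at the
    end.\<close>
  moreover have "(1 - a) * s \<le> (1 - a) * p"
    using sp[OF adm(2) prof(1)] loc range
    by (simp add: upd agent_cost_paired flip: s_def p_def)
  ultimately show ?thesis
    using a by (simp flip: s_def p_def)
qed

text \<open>Any test point \<open>z\<close> bounds the infimum from above, so optimality of
  \<open>z\<close> need not be proved. Taking \<open>max 0 \<rho>\<close> keeps the multiplication
  monotone for negative \<open>\<rho>\<close>.\<close>

lemma max_cost_le_ratio:
  assumes "has_max_cost_ratio f \<rho>" "n \<ge> 1" "m \<ge> 1" "\<alpha> \<in> factor_vectors m"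
    and "r \<in> admissible_profiles n m \<alpha>" "z \<in> {0..1}"
    and nonneg: "\<And>y. y \<in> {0..1} \<Longrightarrow> 0 \<le> max_cost n \<alpha> r y"
  shows "max_cost n \<alpha> r (f n m \<alpha> r) \<le> max 0 \<rho> * max_cost n \<alpha> r z"
proof -
  let ?M = "INF y\<in>{0..1}. max_cost n \<alpha> r y"
  have M: "0 \<le> ?M" "?M \<le> max_cost n \<alpha> r z"
    using max_cost_attains_Inf[OF \<open>n \<ge> 1\<close>, of \<alpha> r] nonneg \<open>z \<in> {0..1}\<close> by metis+
  have "max_cost n \<alpha> r (f n m \<alpha> r) \<le> \<rho> * ?M"
    using assms unfolding has_max_cost_ratio_def by blast
  also have "\<dots> \<le> max 0 \<rho> * max_cost n \<alpha> r z"
    using M by (intro mult_mono) auto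
  finally show ?thesis .
qed

theorem theorem8:
  fixes \<rho> :: real
  assumes "\<rho> < 2 * (1 + 2 * sqrt 2) / 7"
  shows "\<not> (\<exists>f. is_mechanism f \<and> strategyproof_private_groups f \<and> has_max_cost_ratio f \<rho>)"
proof
  assume "\<exists>f. is_mechanism f \<and> strategyproof_private_groups f \<and> has_max_cost_ratio f \<rho>"
  then obtain f where f: "is_mechanism f" "strategyproof_private_groups f"
    and ratio: "has_max_cost_ratio f \<rho>" by blast
  have sqrt2: "1 < sqrt 2" "sqrt 2 < 2" "sqrt 2 * sqrt 2 = 2"
    using real_sqrt_less_mono[of 2 4] by simp_all
  define a where "a = 2 - sqrt 2"
  have a: "0 \<le> a" "a < 1"
    using sqrt2 by (auto simp: a_def)
  let ?\<alpha> = "const_factors a"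
  have \<alpha>: "?\<alpha> \<in> factor_vectors 3"
    using a by (simp add: const_factors_in_factor_vectors)
  have adm: "separate_profile \<in> admissible_profiles 3 3 ?\<alpha>"
    "paired_profile \<in> admissible_profiles 3 3 ?\<alpha>"
    using a by (simp_all add: separate_profile_admissible paired_profile_admissible)
  define y where "y = f 3 3 ?\<alpha> separate_profile"
  have y': "f 3 3 ?\<alpha> paired_profile = y"
    using strategyproof_same_location[OF f a] by (simp add: y_def)
  have y: "y \<in> {0..1}"
    using f(1) \<alpha> adm(1) unfolding is_mechanism_def admissible_profiles_def y_def by simp
  define \<sigma> where "\<sigma> = max 0 \<rho>"
  \<comment> \<open>The bound is positive, so truncation at 0 stays below it.\<close>
  have \<sigma>: "\<sigma> < 2 * (1 + 2 * sqrt 2) / 7"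
    using assms sqrt2(1) unfolding \<sigma>_def max_def by (auto intro: add_pos_pos)
  have "max_cost 3 ?\<alpha> separate_profile y \<le> \<sigma> * max_cost 3 ?\<alpha> separate_profile (1 / 2)"
    unfolding \<sigma>_def y_def using \<alpha> adm
    by (intro max_cost_le_ratio[OF ratio]) (auto simp: max_cost_separate)
  then have "y \<le> \<sigma> / 2"
    using y by (simp add: max_cost_separate max_def split: if_splits)
  \<comment> \<open>Scaling by \<open>1 - a = sqrt 2 - 1\<close> matches the coefficient of
    \<open>y\<close> in the paired cost.\<close>
  then have "(sqrt 2 - 1) * y \<le> (sqrt 2 - 1) * (\<sigma> / 2)"
    using sqrt2 by (intro mult_left_mono) auto
  \<comment> \<open>The point \<open>sqrt 2 / 2 = 1 / (2 - a)\<close> is where \<open>z\<close> and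
    \<open>1 - (1 - a) * z\<close> meet.\<close>
  moreover have "max_cost 3 ?\<alpha> paired_profile y \<le> \<sigma> * max_cost 3 ?\<alpha> paired_profile (sqrt 2 / 2)"
    unfolding \<sigma>_def y'[symmetric] using \<alpha> adm sqrt2
    by (intro max_cost_le_ratio[OF ratio]) (auto simp: max_cost_paired)
  moreover have "max_cost 3 ?\<alpha> paired_profile (sqrt 2 / 2) = sqrt 2 / 2"
    using sqrt2 by (simp add: max_cost_paired a_def field_simps)
  moreover have "1 - (sqrt 2 - 1) * y \<le> max_cost 3 ?\<alpha> paired_profile y"
    using y by (simp add: max_cost_paired a_def)
  ultimately have "1 \<le> \<sigma> * (sqrt 2 - 1 / 2)"
    by (simp add: algebra_simps)
  also have "\<dots> < 2 * (1 + 2 * sqrt 2) / 7 * (sqrt 2 - 1 / 2)"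
    using \<sigma> sqrt2(1) by (intro mult_strict_right_mono) linarith+
  \<comment> \<open>The claimed bound is the reciprocal of \<open>sqrt 2 - 1 / 2\<close>.\<close>
  also have "\<dots> = 1"
    using sqrt2(3) by (simp add: algebra_simps)
  finally show False by simp
qed

end
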